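(* Let $H$, $\Omega$, $J$, $\{g_j\}_{j\in J}$, $C$, the control $\{i(n)\}$, the relaxation parameters $\{\lambda_n\}$, the perturbations $\{b_n\}$, the number $\mu>d(x_0,C)$ and the $0$-subgradients $\{t_n\}$ be as described in the context, with all assumptions listed there (including Conditions 1, 2, 3). Then any sequence $\{x_n\}_{n=0}^{\infty}$ generated by the Sequential Subgradient Projection algorithm with perturbations converges weakly to a point in the set $B[x_0,2\mu]\cap C$, where $B[x_0,2\mu]$ is the closed ball of radius $2\mu$ centered at $x_0$. In addition, if either $H$ is finite-dimensional or the set $B[x_0,2\mu]\cap C$ has a nonempty interior with respect to $H$, then the sequence converges in norm to a point in this set.
   Context: $H$ is a real Hilbert space with inner product $\langle\cdot,\cdot\rangle$ and norm $\|\cdot\|$; $\Omega\subseteq H$ is nonempty, closed and convex; $P_\Omega$ is the orthogonal (best approximation) projection onto $\Omega$. For $x\in H$ and $A\subseteq H$, $d(x,A)=\inf\{\|x-a\| : a\in A\}$. Zero-convexity. For $g:\Omega\to\mathbb{R}$ let $g^{\leq 0}=\{x\in\Omega : g(x)\leq 0\}$. A vector $t\in H$ is a $0$-subgradient of $g$ at $y\in\Omega$ if $g(y)+\langle t,x-y\rangle\leq 0$ for all $x\in g^{\leq 0}$; the set of all of these is denoted $\partial^0 g(y)$. $g$ is zero-convex if $\partial^0 g(y)\neq\emptyset$ for every $y\in\Omega$. Feasibility problem. $J$ is a finite or countable index set; for each $j\in J$, $g_j:\Omega\to\mathbb{R}$ is continuous and zero-convex, $C_j=\{x\in\Omega : g_j(x)\leq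 0\}$, and $C=\bigcap_{j\in J}C_j\neq\emptyset$. Control. $\{i(n)\}_{n=0}^\infty$ is a sequence in $J$ such that for each $j\in J$ there is $L_j\in\mathbb{N}$ such that for all $s\in\mathbb{N}$, $j\in\{i(s),i(s+1),\ldots,i(s+L_j-1)\}$. Algorithm (Sequential Subgradient Projection algorithm with perturbations). $x_0\in\Omega$ is arbitrary, and for $n\geq 0$, $$x_{n+1}=\begin{cases}P_\Omega\left(x_n-\lambda_n\dfrac{g_{i(n)}(x_n)}{\|t_n\|^2}t_n+b_n\right), & \text{if } g_{i(n)}(x_n)>0,\\ x_n, & \text{if } g_{i(n)}(x_n)\leq 0,\end{cases}$$ where $t_n\in\partial^0 g_{i(n)}(x_n)$, $\{b_n\}_{n=0}^\infty$ is a sequence in $H$, and $\{\lambda_n\}_{n=0}^\infty$ are real numbers with $\epsilon_1\leq\lambda_n\leq 2-\epsilon_2$ for all $n\geq 0$, for fixed $\epsilon_1,\epsilon_2>0$ with $\epsilon_1+\epsilon_2\leq 2$. (When $g_{i(n)}(x_n)>0$ one automatically has $t_n\neq 0$.) Condition 1. $\mu>0$ is a fixed number with $\mu>d(x_0,C)$, and for all $n\in\mathbb{N}\cup\{0\}$, $$\|b_n\|\leq\min\left(\mu,\frac{\epsilon_1\epsilon_2h_n^2}{2(5\mu+4h_n)}\right),\qquad h_n=\begin{cases}g_{i(n)}(x_n)/\|t_n\|, & \text{if } g_{i(n)}(x_n)>0,\\ 0, & \text{if } g_{i(n)}(x_n)\leq 0.\end{cases}$$ Condition 2. For each $j\in J$,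 $g_j$ is zero-convex, uniformly continuous on closed and bounded subsets of $\Omega$, and weakly sequentially lower semicontinuous. Condition 3. There is $K>0$ such that $\|t_n\|\leq K$ for all $n\in\mathbb{N}\cup\{0\}$. *)

theory Defs
  imports "HOL-Analysis.Analysis"
begin

(* A function on Omega is a total function of which only the values on Omega are used. *)

definition zero_sublevel :: "'a set \<Rightarrow> ('a \<Rightarrow> real) \<Rightarrow> 'a set"
  where "zero_sublevel \<Omega> g = {x \<in> \<Omega>. g x \<le> 0}"

definition zero_subdiff :: "'a::real_inner set \<Rightarrow> ('a \<Rightarrow> real) \<Rightarrow> 'a \<Rightarrow> 'a set"
  where "zero_subdiff \<Omega> g y = {t. \<forall>x \<in> zero_sublevel \<Omega> g. g y + t \<bullet> (x - y) \<le> 0}"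

definition zero_convex_on :: "'a::real_inner set \<Rightarrow> ('a \<Rightarrow> real) \<Rightarrow> bool"
  where "zero_convex_on \<Omega> g \<longleftrightarrow> (\<forall>y \<in> \<Omega>. zero_subdiff \<Omega> g y \<noteq> {})"

(* The library's closest_point is defined by the same formula, but its sort constraint
   heine_borel would force the space to be finite-dimensional. *)
definition best_approx :: "'a::real_inner set \<Rightarrow> 'a \<Rightarrow> 'a"
  where "best_approx S a = (SOME x. x \<in> S \<and> (\<forall>y \<in> S. dist a x \<le> dist a y))"

definition weakly_tendsto :: "(nat \<Rightarrow> 'a::real_inner) \<Rightarrow> 'a \<Rightarrow> bool"
  where "weakly_tendsto X l \<longleftrightarrow> (\<forall>y. (\<lambda>n. X n \<bullet> y) \<longlonglongrightarrow> l \<bullet> y)"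

definition weakly_seq_lsc_on :: "'a::real_inner set \<Rightarrow> ('a \<Rightarrow> real) \<Rightarrow> bool"
  where "weakly_seq_lsc_on \<Omega> g \<longleftrightarrow>
    (\<forall>X l. (\<forall>n. X n \<in> \<Omega>) \<longrightarrow> l \<in> \<Omega> \<longrightarrow> weakly_tendsto X l \<longrightarrow>
       ereal (g l) \<le> liminf (\<lambda>n. ereal (g (X n))))"

end

theory Submission
  imports Defs "HOL-Complex_Analysis.Great_Picard"
begin

text \<open>
  Put $S = B[x_0,2\mu] \cap C$. By the subgradient inequality an unperturbed
  step from $x_n$ decreases the squared distance to any $q \in C$ by at least
  $\epsilon_1\epsilon_2 h_n^2$, and the bound on $b_n$ is chosen so that, as long as
  $\|x_n-q\| \le 2\mu$, the perturbation gives back at most half of this, while the projection onto $\Omega$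
  only brings the point closer to $q$ (\<open>perturbed_subgradient_step\<close>). For $q \in S$ the condition $\|x_n-q\| \le 2\mu$
  holds at $n=0$ and then reproduces itself, so $x$ is Fejer monotone with respect to $S$.
  The set $S$ is nonempty because $d(x_0,C) < \mu$. Telescoping the decrease gives
  $h_n \to 0$, hence $b_n \to 0$, $\|x_{n+1}-x_n\| \to 0$ and, since the $t_n$ are bounded,
  $\limsup g_{i(n)}(x_n) \le 0$.

  Weak cluster points lie in $S$. If $x_{r_k} \rightharpoonup z$ and $j \in J$, the control
  provides $m_k$ within a fixed distance after $r_k$ with $i(m_k) = j$. As increments vanish,
  $x_{m_k} \rightharpoonup z$ too, and weak lower semicontinuity yields $g_j(z) \le 0$. That $z$
  stays within $2\mu$ of $x_0$ comes from a point $q \in C$ with $\|x_0-q\| < \mu$: the whole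
  sequence remains in $B[q,\mu]$. Opial's argument (\<open>fejer_monotone_weakly_tendsto\<close>) then gives
  weak convergence.

  In finite dimension weak and norm convergence agree
  (\<open>finite_dim_weakly_tendsto_imp_tendsto\<close>); if $S$ has an interior point, Fejer monotonicity
  forces the sequence to be Cauchy (\<open>fejer_monotone_interior_imp_convergent\<close>).

  The Hilbert space facts used here, existence of projections and weak sequential compactness of
  bounded sequences, are both derived from one principle: a decreasing sequence of nonempty
  bounded closed convex sets has a common point (\<open>nested_closed_convex_inter_nonempty\<close>).
\<close>

section \<open>Nested closed convex sets and projections\<close>

text \<open>
  The points of almost minimal norm in the sets $K_n$ form a Cauchy sequence: the midpoint of two
  such points of $K_n$ is again in $K_n$, so it cannot be much shorter than they are, and the
  parallelogram law then bounds their distance.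
\<close>

lemma nested_closed_convex_inter_nonempty:
  fixes K :: "nat \<Rightarrow> 'a::{real_inner, complete_space} set"
  assumes closed: "\<And>n. closed (K n)" and convex: "\<And>n. convex (K n)"
    and nonempty: "\<And>n. K n \<noteq> {}" and decr: "decseq K" and bounded: "bounded (K 0)"
  shows "(\<Inter>n. K n) \<noteq> {}"
proof -
  define d where "d n = infdist 0 (K n)" for n
  obtain R where R: "\<And>y. y \<in> K 0 \<Longrightarrow> norm y \<le> R"
    using bounded unfolding bounded_iff by blast
  have d_le: "d n \<le> norm y" if "y \<in> K n" for n y
    using infdist_le[OF that, of 0] by (simp add: d_def)
  have d_nonneg: "0 \<le> d n" for n
    by (simp add: d_def infdist_nonneg)
  have "incseq d"
    unfolding d_def by (intro incseq_SucI infdist_mono decseq_SucD[OF decr] nonempty)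
  moreover have "d n \<le> R" for n
  proof -
    obtain y where "y \<in> K n" using nonempty by blast
    moreover from this have "y \<in> K 0" using decseqD[OF decr, of 0 n] by auto
    ultimately show ?thesis using d_le R by fastforce
  qed
  ultimately obtain D where D: "d \<longlonglongrightarrow> D" and d_D: "\<And>n. d n \<le> D"
    by (metis incseq_convergent)
  have "\<exists>y\<in>K n. norm y < d n + 1 / (real n + 1)" for n
  proof -
    have "(INF y\<in>K n. dist 0 y) < d n + 1 / (real n + 1)"
      using nonempty by (simp add: d_def infdist_notempty)
    then show ?thesis
      using cInf_lessD[of "dist 0 ` K n"] nonempty[of n] by auto
  qed
  then obtain y where yK: "\<And>n. y n \<in> K n" and yd: "\<And>n. norm (y n) < d n + 1 / (real n + 1)"
    by metis
  have y_in: "y m \<in> K n" if "n \<le> m" for n m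
    using yK decseqD[OF decr that] by blast
  define e where "e n = 4 * (D + 1 / (real n + 1))\<^sup>2 - 4 * (d n)\<^sup>2" for n
  have yD: "norm (y m) \<le> D + 1 / (real n + 1)" if "n \<le> m" for m n
  proof -
    have "1 / (real m + 1) \<le> 1 / (real n + 1)"
      using that by (intro divide_left_mono) auto
    then show ?thesis using yd[of m] d_D[of m] by linarith
  qed
  have close: "(norm (y m - y n))\<^sup>2 \<le> e n" if "n \<le> m" for m n
  proof -
    have "(1/2) *\<^sub>R y m + (1/2) *\<^sub>R y n \<in> K n"
      using convex[of n] y_in[OF that] yK[of n] by (intro convexD) auto
    then have "d n \<le> norm ((1/2) *\<^sub>R (y m + y n))"
      using d_le by (simp add: scaleR_add_right)
    then have "2 * d n \<le> norm (y m + y n)" by simp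
    then have "(2 * d n)\<^sup>2 \<le> (norm (y m + y n))\<^sup>2"
      using d_nonneg by (intro power_mono) auto
    moreover have "(norm (y m - y n))\<^sup>2 = 2 * (norm (y m))\<^sup>2 + 2 * (norm (y n))\<^sup>2 - (norm (y m + y n))\<^sup>2"
      by (simp add: power2_norm_eq_inner inner_simps inner_commute)
    moreover have "(norm (y m))\<^sup>2 \<le> (D + 1 / (real n + 1))\<^sup>2" "(norm (y n))\<^sup>2 \<le> (D + 1 / (real n + 1))\<^sup>2"
      using yD that by (auto intro!: power_mono)
    ultimately show ?thesis by (simp add: e_def power_mult_distrib)
  qed
  have "(\<lambda>n. 1 / (real n + 1)) \<longlonglongrightarrow> 0"
    using LIMSEQ_inverse_real_of_nat by (simp add: inverse_eq_divide add.commute)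
  from tendsto_add[OF tendsto_const[of D] this]
  have "e \<longlonglongrightarrow> 4 * (D + 0)\<^sup>2 - 4 * D\<^sup>2"
    unfolding e_def by (intro tendsto_diff tendsto_mult tendsto_power tendsto_const D)
  then have e0: "e \<longlonglongrightarrow> 0" by simp
  have "Cauchy y"
    unfolding Cauchy_altdef2
  proof (intro allI impI)
    fix \<epsilon> :: real assume "\<epsilon> > 0"
    then have "eventually (\<lambda>n. e n < \<epsilon>\<^sup>2) sequentially"
      using e0 by (intro order_tendstoD) auto
    then obtain N where N: "e N < \<epsilon>\<^sup>2"
      unfolding eventually_sequentially by auto
    have "dist (y n) (y N) < \<epsilon>" if "n \<ge> N" for n
      using close[OF that] N \<open>\<epsilon> > 0\<close> by (auto simp: dist_norm intro: power2_less_imp_less)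
    then show "\<exists>N. \<forall>n\<ge>N. dist (y n) (y N) < \<epsilon>" by blast
  qed
  then obtain l where l: "y \<longlonglongrightarrow> l"
    using Cauchy_convergent convergent_def by blast
  have "l \<in> K n" for n
  proof (rule Lim_in_closed_set[OF closed _ _ l])
    show "\<forall>\<^sub>F m in sequentially. y m \<in> K n"
      using y_in by (auto simp: eventually_sequentially)
  qed auto
  then show ?thesis by blast
qed

text \<open>
  The minimisers are the common points of $S$ with closed balls around $a$ whose radii decrease
  to the distance; this shows that the choice in \<open>best_approx\<close> has a witness.
\<close>

lemma best_approx_props:
  fixes S :: "'a::{real_inner, complete_space} set"
  assumes "closed S" "convex S" "S \<noteq> {}"
  shows best_approx_in: "best_approx S a \<in> S"
    and best_approx_le: "y \<in> S \<Longrightarrow> dist a (best_approx S a) \<le> dist a y"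
proof -
  define K where "K n = S \<inter> cball a (infdist a S + 1 / (real n + 1))" for n
  have "(\<Inter>n. K n) \<noteq> {}"
  proof (rule nested_closed_convex_inter_nonempty)
    show "K n \<noteq> {}" for n
    proof -
      have "(INF y\<in>S. dist a y) < infdist a S + 1 / (real n + 1)"
        using assms(3) by (simp add: infdist_notempty)
      then obtain y where "y \<in> S" "dist a y < infdist a S + 1 / (real n + 1)"
        using cInf_lessD[of "dist a ` S"] assms(3) by auto
      then show ?thesis unfolding K_def by force
    qed
    show "decseq K"
    proof (intro decseq_SucI)
      fix n
      have "1 / (real (Suc n) + 1) \<le> 1 / (real n + 1)"
        by (intro divide_left_mono) auto
      then show "K (Suc n) \<subseteq> K n" unfolding K_def by auto
    qed
  qed (auto simp: K_def assms closed_Int convex_Int intro: bounded_Int)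
  then obtain p where p: "\<And>n. p \<in> K n" by blast
  have "dist a p \<le> infdist a S"
  proof (rule LIMSEQ_le_const)
    have "(\<lambda>n. 1 / (real n + 1)) \<longlonglongrightarrow> 0"
      using LIMSEQ_inverse_real_of_nat by (simp add: inverse_eq_divide add.commute)
    from tendsto_add[OF tendsto_const[of "infdist a S"] this]
    show "(\<lambda>n. infdist a S + 1 / (real n + 1)) \<longlonglongrightarrow> infdist a S" by simp
    show "\<exists>N. \<forall>n\<ge>N. dist a p \<le> infdist a S + 1 / (real n + 1)"
      using p by (auto simp: K_def)
  qed
  then have "p \<in> S \<and> (\<forall>y\<in>S. dist a p \<le> dist a y)"
    using p infdist_le[of _ S a] by (force simp: K_def)
  then have *: "best_approx S a \<in> S \<and> (\<forall>y\<in>S. dist a (best_approx S a) \<le> dist a y)"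
    unfolding best_approx_def by (rule someI)
  show "best_approx S a \<in> S" using * by blast
  show "y \<in> S \<Longrightarrow> dist a (best_approx S a) \<le> dist a y" using * by blast
qed

lemma best_approx_obtuse:
  fixes S :: "'a::{real_inner, complete_space} set"
  assumes "closed S" "convex S" "y \<in> S"
  shows "(a - best_approx S a) \<bullet> (y - best_approx S a) \<le> 0"
  using any_closest_point_dot[OF assms(2,1) _ assms(3)] best_approx_props[OF assms(1,2)] assms(3) by blast

text \<open>
  The angle at the projection between $a$ and $q$ is obtuse, so the side from $a$ to $q$ is the
  longest of the triangle.
\<close>

lemma best_approx_closer:
  fixes S :: "'a::{real_inner, complete_space} set"
  assumes "closed S" "convex S" "q \<in> S"
  shows "norm (best_approx S a - q) \<le> norm (a - q)"
proof (rule power2_le_imp_le)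
  let ?p = "best_approx S a"
  have "(norm (a - q))\<^sup>2 = (norm (a - ?p))\<^sup>2 + (norm (?p - q))\<^sup>2 - 2 * ((a - ?p) \<bullet> (q - ?p))"
    by (simp add: power2_norm_eq_inner inner_simps inner_commute)
  then show "(norm (?p - q))\<^sup>2 \<le> (norm (a - q))\<^sup>2"
    using best_approx_obtuse[OF assms, of a] zero_le_power2[of "norm (a - ?p)"] by linarith
qed simp

section \<open>Weak convergence and weak sequential compactness\<close>

text \<open>
  Test weak convergence against $l - p$, where $p$ is the projection of $l$: all $X_n$ lie in the
  half space $\langle l-p, w-p\rangle \le 0$, hence so does $l$, which forces $l = p$.
\<close>

lemma weak_limit_in_closed_convex:
  fixes S :: "'a::{real_inner, complete_space} set"
  assumes "closed S" "convex S" "\<And>n. X n \<in> S" "weakly_tendsto X l"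
  shows "l \<in> S"
proof -
  let ?p = "best_approx S l"
  have "(\<lambda>n. X n \<bullet> (l - ?p)) \<longlonglongrightarrow> l \<bullet> (l - ?p)"
    using assms(4) unfolding weakly_tendsto_def by blast
  from tendsto_diff[OF this tendsto_const[of "?p \<bullet> (l - ?p)"]]
  have "(\<lambda>n. (X n - ?p) \<bullet> (l - ?p)) \<longlonglongrightarrow> (l - ?p) \<bullet> (l - ?p)"
    by (simp add: inner_diff_left)
  then have "(l - ?p) \<bullet> (l - ?p) \<le> 0"
    by (rule LIMSEQ_le_const2)
      (use best_approx_obtuse[OF assms(1,2) assms(3)] in \<open>auto simp: inner_commute\<close>)
  then have "l - ?p = 0" by (metis inner_ge_zero inner_eq_zero_iff order_antisym)
  then have "l = ?p" by simp
  then show ?thesis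
    using best_approx_in[OF assms(1,2)] assms(3) by (metis empty_iff)
qed

lemma convergent_inner_closed_subspace:
  fixes X :: "nat \<Rightarrow> 'a::real_inner"
  assumes bound: "\<And>n. norm (X n) \<le> M"
  shows "subspace {y. convergent (\<lambda>n. X n \<bullet> y)}" and "closed {y. convergent (\<lambda>n. X n \<bullet> y)}"
proof -
  let ?V = "{y. convergent (\<lambda>n. X n \<bullet> y)}"
  show "subspace ?V"
    by (auto simp: subspace_def inner_add_right intro: convergent_add convergent_mult convergent_const)
  have "M \<ge> 0" using bound[of 0] norm_ge_zero order_trans by blast
  show "closed ?V"
    unfolding closure_subset_eq[symmetric]
  proof
    fix y assume "y \<in> closure ?V"
    then have appr: "\<forall>e>0. \<exists>v\<in>?V. dist v y < e" by (simp add: closure_approachable)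
    have "Cauchy (\<lambda>n. X n \<bullet> y)"
      unfolding Cauchy_altdef2
    proof (intro allI impI)
      fix e :: real assume "e > 0"
      then have "e / (4 * (M + 1)) > 0" using \<open>M \<ge> 0\<close> by simp
      then obtain v where v: "convergent (\<lambda>n. X n \<bullet> v)" "dist v y < e / (4 * (M + 1))"
        using appr by blast
      have near: "\<bar>X n \<bullet> y - X n \<bullet> v\<bar> \<le> e / 4" for n
      proof -
        have "\<bar>X n \<bullet> y - X n \<bullet> v\<bar> \<le> norm (X n) * norm (y - v)"
          by (metis Cauchy_Schwarz_ineq2 inner_diff_right)
        also have "\<dots> \<le> (M + 1) * (e / (4 * (M + 1)))"
          using bound[of n] v(2) \<open>M \<ge> 0\<close>
          by (intro mult_mono) (auto simp: dist_norm norm_minus_commute)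
        also have "\<dots> = e / 4" using \<open>M \<ge> 0\<close> by (simp add: divide_simps)
        finally show ?thesis .
      qed
      from v(1) have "Cauchy (\<lambda>n. X n \<bullet> v)" by (rule convergent_Cauchy)
      then obtain N where N: "\<And>n. n \<ge> N \<Longrightarrow> dist (X n \<bullet> v) (X N \<bullet> v) < e / 2"
        unfolding Cauchy_altdef2 using \<open>e > 0\<close> half_gt_zero by blast
      have "dist (X n \<bullet> y) (X N \<bullet> y) < e" if "n \<ge> N" for n
        using N[OF that] near[of n] near[of N] unfolding dist_real_def by linarith
      then show "\<exists>N. \<forall>n\<ge>N. dist (X n \<bullet> y) (X N \<bullet> y) < e" by blast
    qed
    then show "y \<in> ?V" by (simp add: Cauchy_convergent)
  qed
qed

text \<open>
  The directions $y$ along which $\langle X_n, y\rangle$ converges form a closed subspace $V$ that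
  contains every $X_n$. So the component of $y$ orthogonal to $V$ is orthogonal to all $X_n$ and
  trivially belongs to $V$, which means that $V$ is the whole space.
\<close>

lemma convergent_inner_everywhere:
  fixes X :: "nat \<Rightarrow> 'a::{real_inner, complete_space}"
  assumes bound: "\<And>n. norm (X n) \<le> M"
    and conv: "\<And>m. convergent (\<lambda>n. X n \<bullet> X m)"
  shows "convergent (\<lambda>n. X n \<bullet> y)"
proof -
  define V where "V = {y. convergent (\<lambda>n. X n \<bullet> y)}"
  have sub: "subspace V" and cl: "closed V"
    unfolding V_def using convergent_inner_closed_subspace[of X, OF bound] by auto
  let ?p = "best_approx V y"
  have pV: "?p \<in> V"
    using best_approx_in[OF cl subspace_imp_convex[OF sub]] subspace_0[OF sub] by blast
  have "X n \<bullet> (y - ?p) = 0" for n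
  proof -
    have XV: "X n \<in> V" using conv by (simp add: V_def)
    have "(y - ?p) \<bullet> (?p + X n - ?p) \<le> 0" "(y - ?p) \<bullet> (?p - X n - ?p) \<le> 0"
      by (intro best_approx_obtuse cl subspace_imp_convex sub subspace_add subspace_diff pV XV)+
    then show ?thesis by (simp add: inner_commute)
  qed
  then have "y - ?p \<in> V" by (simp add: V_def convergent_const)
  then have "?p + (y - ?p) \<in> V" by (intro subspace_add sub pV)
  then show ?thesis by (simp add: V_def)
qed

text \<open>
  A common point of the closed convex hulls of all tails is the weak limit: if $\langle X_n,y\rangle$
  tends to $c$, a tail and hence its closed convex hull lies in a slab
  $|\langle w,y\rangle - c| \le \varepsilon$.
\<close>

lemma convergent_inner_imp_weakly_tendsto:
  fixes X :: "nat \<Rightarrow> 'a::{real_inner, complete_space}"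
  assumes bound: "\<And>n. norm (X n) \<le> M"
    and conv: "\<And>y. convergent (\<lambda>n. X n \<bullet> y)"
  shows "\<exists>z. weakly_tendsto X z"
proof -
  define K where "K n = closure (convex hull (X ` {n..}))" for n
  have "(\<Inter>n. K n) \<noteq> {}"
  proof (rule nested_closed_convex_inter_nonempty)
    show "decseq K"
      unfolding K_def by (intro decseq_SucI closure_mono hull_mono image_mono) auto
    have "bounded (X ` {0..})" using bound by (auto simp: bounded_iff)
    then show "bounded (K 0)"
      unfolding K_def by (intro bounded_closure bounded_convex_hull)
  qed (auto simp: K_def convex_closure)
  then obtain z where z: "\<And>n. z \<in> K n" by blast
  have "(\<lambda>n. X n \<bullet> y) \<longlonglongrightarrow> z \<bullet> y" for y
  proof -
    obtain c where c: "(\<lambda>n. X n \<bullet> y) \<longlonglongrightarrow> c" using conv convergent_def by blast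
    have "\<bar>y \<bullet> z - c\<bar> \<le> e" if "e > 0" for e
    proof -
      obtain N where N: "\<And>n. n \<ge> N \<Longrightarrow> \<bar>X n \<bullet> y - c\<bar> < e"
        using LIMSEQ_D[OF c \<open>e > 0\<close>] by auto
      let ?T = "{w. y \<bullet> w \<le> c + e} \<inter> {w. y \<bullet> w \<ge> c - e}"
      have "X ` {N..} \<subseteq> ?T" using N by (force simp: inner_commute abs_less_iff)
      then have "K N \<subseteq> ?T"
        unfolding K_def
        by (intro closure_minimal hull_minimal convex_Int convex_halfspace_le convex_halfspace_ge
            closed_Int closed_halfspace_le closed_halfspace_ge)
      then have "z \<in> ?T" using z[of N] by blast
      then show ?thesis by (simp add: abs_le_iff)
    qed
    then have "\<bar>y \<bullet> z - c\<bar> \<le> 0" by (rule field_le_epsilon) simp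
    then show ?thesis using c by (simp add: inner_commute)
  qed
  then show ?thesis by (auto simp: weakly_tendsto_def)
qed

text \<open>
  A diagonal argument need only make $\langle X_{r_n}, y\rangle$ converge for the countably many
  $y$ in the range of $X$; by \<open>convergent_inner_everywhere\<close> all other directions follow.
\<close>

lemma bounded_imp_weakly_convergent_subsequence:
  fixes X :: "nat \<Rightarrow> 'a::{real_inner, complete_space}"
  assumes bound: "\<And>n. norm (X n) \<le> M"
  obtains r z where "strict_mono r" "weakly_tendsto (X \<circ> r) z"
proof -
  have "M \<ge> 0" using bound[of 0] norm_ge_zero order_trans by blast
  have "norm (X n \<bullet> y) \<le> M * M" if "y \<in> range X" for n y
  proof -
    have "norm (X n \<bullet> y) \<le> norm (X n) * norm y" by (simp add: Cauchy_Schwarz_ineq2)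
    also have "\<dots> \<le> M * M" using that bound \<open>M \<ge> 0\<close> by (intro mult_mono) auto
    finally show ?thesis .
  qed
  then obtain r :: "nat \<Rightarrow> nat" where r: "strict_mono r"
    and lim: "\<And>y. y \<in> range X \<Longrightarrow> \<exists>l. (\<lambda>n. X (r n) \<bullet> y) \<longlonglongrightarrow> l"
    using function_convergent_subsequence[of "range X" "\<lambda>n y. X n \<bullet> y" "M * M"]
      countable_image[OF countableI_type, of X UNIV] by metis
  have bound': "norm ((X \<circ> r) n) \<le> M" for n using bound by simp
  have "convergent (\<lambda>n. (X \<circ> r) n \<bullet> (X \<circ> r) m)" for m
    using lim by (auto simp: convergent_def)
  from convergent_inner_imp_weakly_tendsto[OF bound' convergent_inner_everywhere[OF bound' this]]
  show thesis using r that by blast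
qed

lemma weakly_tendsto_unique:
  assumes "weakly_tendsto X a" "weakly_tendsto X b"
  shows "a = b"
proof -
  have "a \<bullet> (a - b) = b \<bullet> (a - b)"
    using assms LIMSEQ_unique unfolding weakly_tendsto_def by blast
  then have "(a - b) \<bullet> (a - b) = 0" by (simp add: inner_diff_left)
  then show ?thesis by simp
qed

lemma tendsto_imp_weakly_tendsto:
  assumes "X \<longlonglongrightarrow> a"
  shows "weakly_tendsto X a"
  unfolding weakly_tendsto_def using assms by (intro allI tendsto_intros)

lemma weakly_tendsto_diff_null:
  assumes "weakly_tendsto X a" "(\<lambda>n. Y n - X n) \<longlonglongrightarrow> 0"
  shows "weakly_tendsto Y a"
  unfolding weakly_tendsto_def
proof
  fix y
  have "(\<lambda>n. X n \<bullet> y + (Y n - X n) \<bullet> y) \<longlonglongrightarrow> a \<bullet> y + 0 \<bullet> y"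
    using assms(1) unfolding weakly_tendsto_def
    by (intro tendsto_add tendsto_inner[OF assms(2) tendsto_const]) blast
  then show "(\<lambda>n. Y n \<bullet> y) \<longlonglongrightarrow> a \<bullet> y" by (simp add: inner_diff_left)
qed

text \<open>
  In an orthogonal basis the coefficients of a vector are inner products with fixed vectors, so
  they converge along a weakly convergent sequence. A possible zero vector in the basis is
  harmless, as its coefficient $0/0$ is $0$.
\<close>

lemma finite_dim_weakly_tendsto_imp_tendsto:
  fixes X :: "nat \<Rightarrow> 'a::real_inner"
  assumes "finite B" "span B = (UNIV :: 'a set)" "weakly_tendsto X z"
  shows "X \<longlonglongrightarrow> z"
proof -
  obtain E :: "'a set" where E: "finite E" "span E = UNIV" "pairwise orthogonal E"
    using basis_orthogonal[OF assms(1)] assms(2) by auto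
  have expand: "(\<Sum>e\<in>E. (v \<bullet> e / (e \<bullet> e)) *\<^sub>R e) = v" for v :: 'a
  proof -
    let ?w = "v - (\<Sum>e\<in>E. (v \<bullet> e / (e \<bullet> e)) *\<^sub>R e)"
    have "orthogonal ?w f" if "f \<in> E" for f
    proof -
      have "(\<Sum>e\<in>E. (v \<bullet> e / (e \<bullet> e)) * (e \<bullet> f)) = (\<Sum>e\<in>E. if e = f then v \<bullet> f else 0)"
        using E(3) that by (intro sum.cong) (auto simp: pairwise_def orthogonal_def)
      then show ?thesis
        using that E(1) by (simp add: orthogonal_def inner_diff_left inner_sum_left)
    qed
    then have "orthogonal ?w ?w" using orthogonal_to_span[of ?w E ?w] E(2) by simp
    then show ?thesis by (simp add: orthogonal_def)
  qed
  have "(\<lambda>n. \<Sum>e\<in>E. (X n \<bullet> e / (e \<bullet> e)) *\<^sub>R e) \<longlonglongrightarrow> (\<Sum>e\<in>E. (z \<bullet> e / (e \<bullet> e)) *\<^sub>R e)"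
    using assms(3) unfolding weakly_tendsto_def divide_inverse
    by (intro tendsto_sum tendsto_scaleR tendsto_mult tendsto_const) blast
  then show ?thesis by (simp only: expand)
qed

section \<open>Fejer monotone sequences\<close>

definition fejer_monotone :: "(nat \<Rightarrow> 'a::real_inner) \<Rightarrow> 'a set \<Rightarrow> bool"
  where "fejer_monotone X S \<longleftrightarrow> (\<forall>p\<in>S. \<forall>n. norm (X (Suc n) - p) \<le> norm (X n - p))"

lemma fejer_monotone_decseq:
  assumes "fejer_monotone X S" "p \<in> S"
  shows "decseq (\<lambda>n. norm (X n - p))"
proof (rule decseq_SucI)
  fix n
  show "norm (X (Suc n) - p) \<le> norm (X n - p)"
    using assms unfolding fejer_monotone_def by blast
qed

text \<open>
  Opial's argument: $\|X_n - w\|^2 - \|X_n - z\|^2$ converges and differs from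
  $2\langle X_n, z-w\rangle$ by a constant, so $\langle z,z-w\rangle$ and $\langle w,z-w\rangle$ are
  limits of subsequences of the same convergent sequence.
\<close>

lemma fejer_monotone_weak_cluster_unique:
  assumes fejer: "fejer_monotone X S" and "z \<in> S" "w \<in> S"
    and "strict_mono r" "weakly_tendsto (X \<circ> r) z" "strict_mono s" "weakly_tendsto (X \<circ> s) w"
  shows "z = w"
proof -
  have conv: "convergent (\<lambda>n. (norm (X n - p))\<^sup>2)" if p: "p \<in> S" for p
  proof -
    obtain L where "(\<lambda>n. norm (X n - p)) \<longlonglongrightarrow> L"
      using decseq_convergent[OF fejer_monotone_decseq[OF fejer p]] norm_ge_zero by metis
    then show ?thesis using tendsto_power convergent_def by blast
  qed
  have "X n \<bullet> (z - w) = ((norm (X n - w))\<^sup>2 - (norm (X n - z))\<^sup>2 + ((norm z)\<^sup>2 - (norm w)\<^sup>2)) / 2" for n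
    by (simp add: power2_norm_eq_inner inner_simps inner_commute)
  moreover have "convergent (\<lambda>n. ((norm (X n - w))\<^sup>2 - (norm (X n - z))\<^sup>2 + ((norm z)\<^sup>2 - (norm w)\<^sup>2)) / 2)"
    unfolding divide_inverse
    by (intro convergent_mult convergent_add convergent_diff convergent_const conv assms)
  ultimately obtain c where c: "(\<lambda>n. X n \<bullet> (z - w)) \<longlonglongrightarrow> c" by (auto simp: convergent_def)
  have "c = z \<bullet> (z - w)"
    using LIMSEQ_subseq_LIMSEQ[OF c \<open>strict_mono r\<close>] assms(5) LIMSEQ_unique
    unfolding weakly_tendsto_def comp_def by blast
  moreover have "c = w \<bullet> (z - w)"
    using LIMSEQ_subseq_LIMSEQ[OF c \<open>strict_mono s\<close>] assms(7) LIMSEQ_unique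
    unfolding weakly_tendsto_def comp_def by blast
  ultimately have "(z - w) \<bullet> (z - w) = 0" by (simp add: inner_diff_left)
  then show ?thesis by simp
qed

text \<open>
  A Fejer monotone sequence is bounded, so every subsequence has a weakly convergent subsequence,
  and all these limits coincide. If the whole sequence failed to converge against some $y$, a
  subsequence staying away from the common limit in this direction would contradict that.
\<close>

lemma fejer_monotone_weakly_tendsto:
  fixes X :: "nat \<Rightarrow> 'a::{real_inner, complete_space}"
  assumes fejer: "fejer_monotone X S" and "S \<noteq> {}"
    and cluster: "\<And>r z. strict_mono r \<Longrightarrow> weakly_tendsto (X \<circ> r) z \<Longrightarrow> z \<in> S"
  shows "\<exists>z\<in>S. weakly_tendsto X z"
proof -
  obtain p where "p \<in> S" using \<open>S \<noteq> {}\<close> by blast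
  have bound: "norm (X n) \<le> norm (X 0 - p) + norm p" for n
    using decseqD[OF fejer_monotone_decseq[OF fejer \<open>p \<in> S\<close>], of 0 n]
      norm_triangle_ineq[of "X n - p" p] by simp
  obtain r z where rz: "strict_mono r" "weakly_tendsto (X \<circ> r) z"
    using bounded_imp_weakly_convergent_subsequence[OF bound] .
  have "(\<lambda>n. X n \<bullet> y) \<longlonglongrightarrow> z \<bullet> y" for y
  proof (rule LIMSEQ_I, rule ccontr)
    fix e :: real
    assume "e > 0" and "\<nexists>N. \<forall>n\<ge>N. norm (X n \<bullet> y - z \<bullet> y) < e"
    then obtain s :: "nat \<Rightarrow> nat" where s: "strict_mono s"
      and far: "\<And>n. \<not> norm (X (s n) \<bullet> y - z \<bullet> y) < e"
      using not_eventually_sequentiallyD[of "\<lambda>n. norm (X n \<bullet> y - z \<bullet> y) < e"]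
      unfolding eventually_sequentially by auto
    have "norm ((X \<circ> s) n) \<le> norm (X 0 - p) + norm p" for n using bound by simp
    then obtain k w where kw: "strict_mono k" "weakly_tendsto (X \<circ> s \<circ> k) w"
      by (rule bounded_imp_weakly_convergent_subsequence)
    have sk: "strict_mono (s \<circ> k)" using s kw(1) by (rule strict_mono_o)
    have kw': "weakly_tendsto (X \<circ> (s \<circ> k)) w" using kw(2) by (simp add: comp_assoc)
    have "z = w"
      using fejer_monotone_weak_cluster_unique[OF fejer] cluster rz sk kw' by blast
    then have "(\<lambda>n. X (s (k n)) \<bullet> y) \<longlonglongrightarrow> z \<bullet> y"
      using kw' unfolding weakly_tendsto_def by simp
    from LIMSEQ_D[OF this \<open>e > 0\<close>] show False using far by blast
  qed
  then show ?thesis using cluster[OF rz] by (auto simp: weakly_tendsto_def)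
qed

text \<open>
  If a ball $B[q,r]$ lies in $S$, then $X$ comes closer even to the point of the ball that lies
  most directly behind the move from $X_n$ to $X_{n+1}$. Expanding the squares shows that
  the length of the move, times $2r$, is paid for by the decrease of $\|X_n-q\|^2$; so the
  sequence has finite length.
\<close>

lemma fejer_monotone_interior_imp_convergent:
  fixes X :: "nat \<Rightarrow> 'a::{real_inner, complete_space}"
  assumes fejer: "fejer_monotone X S" and "interior S \<noteq> {}"
  shows "convergent X"
proof -
  obtain q r where "r > 0" and ball: "cball q r \<subseteq> S"
    using \<open>interior S \<noteq> {}\<close> mem_interior_cball by (metis ex_in_conv)
  define a where "a n = (norm (X n - q))\<^sup>2" for n
  have gain: "2 * r * norm (X (Suc n) - X n) \<le> a n - a (Suc n)" for n
  proof (cases "X (Suc n) = X n")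
    case False
    \<comment> \<open>\<open>u\<close> is the unit direction of the move; Fejer monotonicity is used at the point \<open>q - r u\<close>.\<close>
    define u where "u = (1 / norm (X (Suc n) - X n)) *\<^sub>R (X (Suc n) - X n)"
    have u: "norm u = 1" and ud: "u \<bullet> (X (Suc n) - X n) = norm (X (Suc n) - X n)"
      using False by (auto simp: u_def dot_square_norm power2_eq_square)
    have "q - r *\<^sub>R u \<in> S" using ball u \<open>r > 0\<close> by (auto simp: dist_norm)
    then have "(norm (X (Suc n) - (q - r *\<^sub>R u)))\<^sup>2 \<le> (norm (X n - (q - r *\<^sub>R u)))\<^sup>2"
      using fejer by (auto simp: fejer_monotone_def intro: power_mono)
    moreover have "(norm (v - (q - r *\<^sub>R u)))\<^sup>2 = (norm (v - q))\<^sup>2 + 2 * r * (u \<bullet> (v - q)) + r * r * (u \<bullet> u)" for v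
      by (simp add: power2_norm_eq_inner inner_simps inner_commute)
      (simp add: algebra_simps power2_eq_square)
    ultimately have "2 * r * (u \<bullet> (X (Suc n) - q)) - 2 * r * (u \<bullet> (X n - q)) \<le> a n - a (Suc n)"
      by (simp add: a_def)
    then show ?thesis by (simp add: ud[symmetric] inner_diff_right algebra_simps)
  qed (simp add: a_def)
  have "decseq a"
    using gain \<open>r > 0\<close> by (intro decseq_SucI) (smt (verit) mult_nonneg_nonneg norm_ge_zero)
  then obtain L where L: "a \<longlonglongrightarrow> L" and La: "\<And>n. L \<le> a n"
    using decseq_convergent[of a 0] by (auto simp: a_def)
  have gap: "2 * r * norm (X (n + l) - X n) \<le> a n - a (n + l)" for n l
  proof (induction l)
    case (Suc l)
    have "2 * r * norm (X (Suc (n + l)) - X n)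
        \<le> 2 * r * (norm (X (Suc (n + l)) - X (n + l)) + norm (X (n + l) - X n))"
      using norm_triangle_ineq[of "X (Suc (n + l)) - X (n + l)" "X (n + l) - X n"] \<open>r > 0\<close>
      by (intro mult_left_mono) auto
    also have "\<dots> \<le> a n - a (Suc (n + l))"
      using gain[of "n + l"] Suc by (simp add: distrib_left)
    finally show ?case by simp
  qed simp
  have "Cauchy X"
    unfolding Cauchy_altdef2
  proof (intro allI impI)
    fix e :: real assume "e > 0"
    then have "\<forall>\<^sub>F n in sequentially. a n < L + 2 * r * e"
      using L \<open>r > 0\<close> by (intro order_tendstoD) auto
    then obtain N where N: "a N < L + 2 * r * e"
      unfolding eventually_sequentially by auto
    have "dist (X n) (X N) < e" if "N \<le> n" for n
    proof -
      have "2 * r * norm (X n - X N) \<le> a N - a n" using gap[of N "n - N"] that by simp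
      then have "2 * r * norm (X n - X N) < 2 * r * e" using N La[of n] by linarith
      then show ?thesis using \<open>r > 0\<close> by (simp add: dist_norm)
    qed
    then show "\<exists>N. \<forall>n\<ge>N. dist (X n) (X N) < e" by blast
  qed
  then show ?thesis by (rule Cauchy_convergent)
qed

section \<open>One step of the perturbed subgradient projection\<close>

lemma zero_subgradient_nonzero:
  assumes "t \<in> zero_subdiff \<Omega> g x" "zero_sublevel \<Omega> g \<noteq> {}" "g x > 0"
  shows "t \<noteq> 0"
  using assms by (auto simp: zero_subdiff_def)

text \<open>
  With $c = \lambda g(x)/\|t\|^2$, the inequality $g(x) \le \langle t, x-q\rangle$ bounds the cross
  term in $\|x-q-ct\|^2$ by $-2\lambda h^2$, while the quadratic term is $\lambda^2h^2$.
\<close>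

lemma relaxed_subgradient_step:
  assumes t: "t \<in> zero_subdiff \<Omega> g x" and q: "q \<in> zero_sublevel \<Omega> g" and pos: "g x > 0"
    and "0 \<le> lam"
  shows "(norm (x - (lam * (g x / (norm t)\<^sup>2)) *\<^sub>R t - q))\<^sup>2
    \<le> (norm (x - q))\<^sup>2 - lam * (2 - lam) * (g x / norm t)\<^sup>2"
proof -
  have "t \<noteq> 0" using zero_subgradient_nonzero[OF t _ pos] q by blast
  define c where "c = lam * (g x / (norm t)\<^sup>2)"
  have "g x \<le> t \<bullet> (x - q)"
    using t q by (auto simp: zero_subdiff_def inner_diff_right)
  then have "c * g x \<le> c * (t \<bullet> (x - q))"
    using pos \<open>0 \<le> lam\<close> by (intro mult_left_mono) (auto simp: c_def)
  moreover have "(norm (x - c *\<^sub>R t - q))\<^sup>2 = (norm (x - q))\<^sup>2 - 2 * (c * (t \<bullet> (x - q))) + c\<^sup>2 * (norm t)\<^sup>2"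
    by (simp add: power2_norm_eq_inner inner_simps inner_commute)
      (simp add: algebra_simps power2_eq_square)
  moreover have "c * g x = lam * (g x / norm t)\<^sup>2"
    by (simp add: c_def power2_eq_square)
  moreover have "c\<^sup>2 * (norm t)\<^sup>2 = lam\<^sup>2 * (g x / norm t)\<^sup>2"
    using \<open>t \<noteq> 0\<close> by (simp add: c_def power2_eq_square)
  ultimately show ?thesis
    unfolding c_def[symmetric] by (simp only: left_diff_distrib right_diff_distrib power2_eq_square[of lam])
qed

text \<open>
  The perturbation adds $2\langle v,b\rangle + \|b\|^2$ to the squared distance, where
  $\|v\| \le \|x-q\| \le 2\mu$ and $\|b\| \le \mu$. This is at most
  $(2\cdot 2\mu + \mu)\|b\| = 5\mu\|b\|$, which explains the constant $5\mu$ in the bound on $b$; that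
  bound makes it at most half of the guaranteed decrease.
\<close>

lemma perturbed_subgradient_step:
  fixes \<Omega> :: "'a::{real_inner, complete_space} set"
  assumes \<Omega>: "closed \<Omega>" "convex \<Omega>" and t: "t \<in> zero_subdiff \<Omega> g x"
    and q: "q \<in> zero_sublevel \<Omega> g" and pos: "g x > 0"
    and \<epsilon>: "\<epsilon>1 > 0" "\<epsilon>2 > 0" and lam: "\<epsilon>1 \<le> lam" "lam \<le> 2 - \<epsilon>2"
    and h: "h = g x / norm t" and "\<mu> > 0"
    and b: "norm b \<le> min \<mu> (\<epsilon>1 * \<epsilon>2 * h\<^sup>2 / (2 * (5 * \<mu> + 4 * h)))"
    and near: "norm (x - q) \<le> 2 * \<mu>"
  shows "(norm (best_approx \<Omega> (x - (lam * (g x / (norm t)\<^sup>2)) *\<^sub>R t + b) - q))\<^sup>2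
    \<le> (norm (x - q))\<^sup>2 - \<epsilon>1 * \<epsilon>2 * h\<^sup>2 / 2"
proof -
  define v where "v = x - (lam * (g x / (norm t)\<^sup>2)) *\<^sub>R t - q"
  have "h \<ge> 0" using h pos by simp
  have "\<epsilon>1 * \<epsilon>2 \<le> lam * (2 - lam)" using \<epsilon> lam by (intro mult_mono) auto
  then have "\<epsilon>1 * \<epsilon>2 * h\<^sup>2 \<le> lam * (2 - lam) * h\<^sup>2" by (intro mult_right_mono) auto
  moreover have "(norm v)\<^sup>2 \<le> (norm (x - q))\<^sup>2 - lam * (2 - lam) * h\<^sup>2"
    unfolding v_def h using relaxed_subgradient_step[OF t q pos] \<epsilon> lam by simp
  ultimately have v2: "(norm v)\<^sup>2 \<le> (norm (x - q))\<^sup>2 - \<epsilon>1 * \<epsilon>2 * h\<^sup>2" by simp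
  also have "\<dots> \<le> (norm (x - q))\<^sup>2" using \<epsilon> by simp
  finally have "norm v \<le> 2 * \<mu>" using near power2_le_imp_le norm_ge_zero order_trans by blast
  have "norm b \<le> \<epsilon>1 * \<epsilon>2 * h\<^sup>2 / (2 * (5 * \<mu> + 4 * h))" using b by simp
  also have "\<dots> \<le> \<epsilon>1 * \<epsilon>2 * h\<^sup>2 / (2 * (5 * \<mu>))"
    using \<epsilon> \<open>\<mu> > 0\<close> \<open>h \<ge> 0\<close> by (intro divide_left_mono) auto
  finally have b5: "5 * \<mu> * norm b \<le> \<epsilon>1 * \<epsilon>2 * h\<^sup>2 / 2"
    using \<open>\<mu> > 0\<close> by (simp add: field_simps)
  have "(norm (best_approx \<Omega> (v + q + b) - q))\<^sup>2 \<le> (norm (v + q + b - q))\<^sup>2"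
    using q by (intro power_mono best_approx_closer \<Omega>) (auto simp: zero_sublevel_def)
  also have "\<dots> \<le> (norm v + norm b)\<^sup>2"
    using norm_triangle_ineq[of v b] by (intro power_mono) auto
  also have "\<dots> = (norm v)\<^sup>2 + (2 * norm v + norm b) * norm b"
    by (simp add: power2_eq_square algebra_simps)
  also have "\<dots> \<le> (norm v)\<^sup>2 + (5 * \<mu>) * norm b"
    using b \<open>norm v \<le> 2 * \<mu>\<close> by (intro add_left_mono mult_right_mono) auto
  also have "\<dots> \<le> (norm (x - q))\<^sup>2 - \<epsilon>1 * \<epsilon>2 * h\<^sup>2 / 2"
    using v2 b5 by simp
  finally show ?thesis by (simp add: v_def)
qed

section \<open>Weak cluster points and feasibility\<close>

text \<open>
  The control revisits an index after a bounded delay, but not at the very times along which a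
  weakly convergent subsequence was chosen; moving by a bounded number of steps changes the
  iterate by a null sequence only.
\<close>

lemma null_increments_imp_null_bounded_gaps:
  fixes X :: "nat \<Rightarrow> 'a::real_normed_vector"
  assumes incr: "(\<lambda>n. norm (X (Suc n) - X n)) \<longlonglongrightarrow> 0"
    and r: "filterlim r at_top sequentially"
    and gap: "\<And>k. r k \<le> m k" "\<And>k. m k \<le> r k + L"
  shows "(\<lambda>k. X (m k) - X (r k)) \<longlonglongrightarrow> 0"
proof (rule Lim_null_comparison)
  have "norm (X (n + l) - X n) \<le> (\<Sum>k<l. norm (X (Suc (n + k)) - X (n + k)))" for n l
    using norm_sum[of "\<lambda>k. X (Suc (n + k)) - X (n + k)" "{..<l}"]
      sum_lessThan_telescope[of "\<lambda>k. X (n + k)" l] by simp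
  also have "(\<Sum>k<l. norm (X (Suc (n + k)) - X (n + k))) \<le> (\<Sum>k<L. norm (X (Suc (n + k)) - X (n + k)))"
    if "l \<le> L" for n l
    using that by (intro sum_mono2) auto
  finally have "norm (X (m k) - X (r k)) \<le> (\<Sum>l<L. norm (X (Suc (r k + l)) - X (r k + l)))" for k
    using gap[of k] le_Suc_ex[of "r k" "m k"] by fastforce
  then show "\<forall>\<^sub>F k in sequentially. norm (X (m k) - X (r k)) \<le> (\<Sum>l<L. norm (X (Suc (r k + l)) - X (r k + l)))"
    by simp
  have "filterlim (\<lambda>k. r k + l) at_top sequentially" for l
    by (rule filterlim_at_top_mono[OF r]) simp
  from filterlim_compose[OF incr this]
  have "(\<lambda>k. \<Sum>l<L. norm (X (Suc (r k + l)) - X (r k + l))) \<longlonglongrightarrow> (\<Sum>l<L. 0)"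
    by (intro tendsto_sum) simp
  then show "(\<lambda>k. \<Sum>l<L. norm (X (Suc (r k + l)) - X (r k + l))) \<longlonglongrightarrow> 0" by simp
qed

lemma weak_limit_in_zero_sublevel:
  assumes lsc: "weakly_seq_lsc_on \<Omega> g" and Y: "\<And>k. Y k \<in> \<Omega>" "weakly_tendsto Y z" and "z \<in> \<Omega>"
    and bound: "\<And>k. g (Y k) \<le> e k" and "e \<longlonglongrightarrow> 0"
  shows "z \<in> zero_sublevel \<Omega> g"
proof -
  have "ereal (g z) \<le> liminf (\<lambda>k. ereal (g (Y k)))"
    using lsc Y \<open>z \<in> \<Omega>\<close> unfolding weakly_seq_lsc_on_def by blast
  also have "\<dots> \<le> liminf (\<lambda>k. ereal (e k))"
    by (rule Liminf_mono) (simp add: bound)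
  also have "\<dots> = ereal 0"
    using \<open>e \<longlonglongrightarrow> 0\<close> by (intro lim_imp_Liminf) auto
  finally show ?thesis using \<open>z \<in> \<Omega>\<close> by (simp add: zero_sublevel_def)
qed

section \<open>Convergence of the algorithm\<close>

theorem theorem1:
  fixes \<Omega> :: "'a::{real_inner, complete_space} set"
    and J :: "'j set"
    and g :: "'j \<Rightarrow> 'a \<Rightarrow> real"
    and C :: "'a set"
    and i :: "nat \<Rightarrow> 'j"
    and x t b :: "nat \<Rightarrow> 'a"
    and lam h :: "nat \<Rightarrow> real"
    and \<epsilon>1 \<epsilon>2 \<mu> :: real
  assumes "\<Omega> \<noteq> {}" and "closed \<Omega>" and "convex \<Omega>"
    and "countable J"
    and "\<And>j. j \<in> J \<Longrightarrow> continuous_on \<Omega> (g j)"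
    and "\<And>j. j \<in> J \<Longrightarrow> zero_convex_on \<Omega> (g j)"
    and C_def: "C = (\<Inter>j\<in>J. zero_sublevel \<Omega> (g j))" and "C \<noteq> {}"
    and "\<And>n. i n \<in> J"
    and control: "\<And>j. j \<in> J \<Longrightarrow> \<exists>L\<ge>1. \<forall>s\<ge>1. j \<in> i ` {s..s + L - 1}"
    and "\<epsilon>1 > 0" and "\<epsilon>2 > 0" and "\<epsilon>1 + \<epsilon>2 \<le> 2"
    and "\<And>n. \<epsilon>1 \<le> lam n" and "\<And>n. lam n \<le> 2 - \<epsilon>2"
    and "x 0 \<in> \<Omega>"
    and "\<And>n. t n \<in> zero_subdiff \<Omega> (g (i n)) (x n)"
    and step: "\<And>n. x (Suc n) =
      (if g (i n) (x n) > 0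
       then best_approx \<Omega> (x n - (lam n * (g (i n) (x n) / (norm (t n))\<^sup>2)) *\<^sub>R t n + b n)
       else x n)"
    and h_def: "\<And>n. h n = (if g (i n) (x n) > 0 then g (i n) (x n) / norm (t n) else 0)"
    and "\<mu> > 0" and "\<mu> > infdist (x 0) C"
    and perturbation:
      "\<And>n. norm (b n) \<le> min \<mu> (\<epsilon>1 * \<epsilon>2 * (h n)\<^sup>2 / (2 * (5 * \<mu> + 4 * h n)))"
    and unif: "\<And>j S. \<lbrakk>j \<in> J; S \<subseteq> \<Omega>; closed S; bounded S\<rbrakk> \<Longrightarrow> uniformly_continuous_on S (g j)"
    and "\<And>j. j \<in> J \<Longrightarrow> weakly_seq_lsc_on \<Omega> (g j)"
    and "\<exists>K>0. \<forall>n. norm (t n) \<le> K"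
  shows "(\<exists>z \<in> cball (x 0) (2 * \<mu>) \<inter> C. weakly_tendsto x z) \<and>
    ((\<exists>B::'a set. finite B \<and> span B = UNIV) \<or> interior (cball (x 0) (2 * \<mu>) \<inter> C) \<noteq> {}
      \<longrightarrow> (\<exists>z \<in> cball (x 0) (2 * \<mu>) \<inter> C. x \<longlonglongrightarrow> z))"
proof -
  define S where "S = cball (x 0) (2 * \<mu>) \<inter> C"
  have \<Omega>: "\<Omega> \<noteq> {}" "closed \<Omega>" "convex \<Omega>" by fact+
  have t: "t n \<in> zero_subdiff \<Omega> (g (i n)) (x n)" for n by fact
  have C\<Omega>: "q \<in> zero_sublevel \<Omega> (g (i n))" if "q \<in> C" for q n
    using that \<open>i n \<in> J\<close> by (auto simp: C_def)
  have h_nonneg: "h n \<ge> 0" for n by (simp add: h_def)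
  have x\<Omega>: "x n \<in> \<Omega>" for n
    by (induction n) (use \<open>x 0 \<in> \<Omega>\<close> best_approx_in[OF \<Omega>(2,3,1)] in \<open>auto simp: step\<close>)
  have decrease: "(norm (x (Suc n) - q))\<^sup>2 \<le> (norm (x n - q))\<^sup>2 - \<epsilon>1 * \<epsilon>2 * (h n)\<^sup>2 / 2"
    if "q \<in> C" "norm (x n - q) \<le> 2 * \<mu>" for q n
  proof (cases "g (i n) (x n) > 0")
    case True
    then have hn: "h n = g (i n) (x n) / norm (t n)" by (simp add: h_def)
    show ?thesis
      using perturbed_subgradient_step[OF \<Omega>(2,3) t C\<Omega>[OF that(1)] True \<open>\<epsilon>1 > 0\<close> \<open>\<epsilon>2 > 0\<close>
          \<open>\<epsilon>1 \<le> lam n\<close> \<open>lam n \<le> 2 - \<epsilon>2\<close> hn \<open>\<mu> > 0\<close> perturbation that(2)] True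
      by (simp add: step)
  qed (simp add: step h_def)
  have closer: "norm (x (Suc n) - q) \<le> norm (x n - q)" if "q \<in> C" "norm (x n - q) \<le> 2 * \<mu>" for q n
  proof (rule power2_le_imp_le)
    have "0 \<le> \<epsilon>1 * \<epsilon>2 * (h n)\<^sup>2 / 2" using \<open>\<epsilon>1 > 0\<close> \<open>\<epsilon>2 > 0\<close> by simp
    then show "(norm (x (Suc n) - q))\<^sup>2 \<le> (norm (x n - q))\<^sup>2" using decrease[OF that] by linarith
  qed simp
  have start: "norm (x 0 - q) \<le> 2 * \<mu>" if "q \<in> S" for q
    using that by (simp add: S_def dist_norm)
  have near: "norm (x n - q) \<le> 2 * \<mu>" if "q \<in> S" for q n
  proof (induction n)
    case (Suc n)
    then show ?case using closer[of q n] that by (auto simp: S_def)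
  qed (rule start[OF that])
  have fejer: "fejer_monotone x S"
    using closer near by (auto simp: fejer_monotone_def S_def)
  have "(INF q\<in>C. dist (x 0) q) < \<mu>"
    using \<open>\<mu> > infdist (x 0) C\<close> \<open>C \<noteq> {}\<close> by (simp add: infdist_notempty)
  then obtain q where q: "q \<in> C" "dist (x 0) q < \<mu>"
    using cInf_lessD[of "dist (x 0) ` C"] \<open>C \<noteq> {}\<close> by auto
  then have qS: "q \<in> S" using \<open>\<mu> > 0\<close> by (simp add: S_def)
  have q_near: "x n \<in> cball q \<mu>" for n
    using decseqD[OF fejer_monotone_decseq[OF fejer qS], of 0 n] q(2)
    by (simp add: dist_norm norm_minus_commute)
  obtain K where "K > 0" and K: "\<And>n. norm (t n) \<le> K"
    using \<open>\<exists>K>0. \<forall>n. norm (t n) \<le> K\<close> by blast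

  \<comment> \<open>The squared distances to \<open>q\<close> converge, so their decrease tends to 0, and it dominates \<open>h\<^sup>2\<close>.\<close>
  have h_null: "h \<longlonglongrightarrow> 0"
  proof -
    obtain L where L: "(\<lambda>n. norm (x n - q)) \<longlonglongrightarrow> L"
      using decseq_convergent[OF fejer_monotone_decseq[OF fejer qS]] norm_ge_zero by metis
    have "(\<lambda>n. ((norm (x n - q))\<^sup>2 - (norm (x (Suc n) - q))\<^sup>2) * (2 / (\<epsilon>1 * \<epsilon>2)))
        \<longlonglongrightarrow> (L\<^sup>2 - L\<^sup>2) * (2 / (\<epsilon>1 * \<epsilon>2))"
      by (intro tendsto_intros L LIMSEQ_Suc[OF L])
    then have null: "(\<lambda>n. ((norm (x n - q))\<^sup>2 - (norm (x (Suc n) - q))\<^sup>2) * (2 / (\<epsilon>1 * \<epsilon>2))) \<longlonglongrightarrow> 0"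
      by simp
    have "(h n)\<^sup>2 \<le> ((norm (x n - q))\<^sup>2 - (norm (x (Suc n) - q))\<^sup>2) * (2 / (\<epsilon>1 * \<epsilon>2))" for n
      using decrease[OF \<open>q \<in> C\<close> near[OF qS], of n] \<open>\<epsilon>1 > 0\<close> \<open>\<epsilon>2 > 0\<close> by (simp add: field_simps)
    then have "(\<lambda>n. (h n)\<^sup>2) \<longlonglongrightarrow> 0"
      by (intro tendsto_sandwich[OF _ _ tendsto_const null]) auto
    then have "(\<lambda>n. sqrt ((h n)\<^sup>2)) \<longlonglongrightarrow> sqrt 0" by (rule tendsto_real_sqrt)
    then show ?thesis using h_nonneg by simp
  qed
  have b_null: "(\<lambda>n. norm (b n)) \<longlonglongrightarrow> 0"
  proof (rule tendsto_sandwich[OF _ _ tendsto_const])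
    have "(\<lambda>n. \<epsilon>1 * \<epsilon>2 * (h n)\<^sup>2 / (2 * (5 * \<mu> + 4 * h n))) \<longlonglongrightarrow> \<epsilon>1 * \<epsilon>2 * 0\<^sup>2 / (2 * (5 * \<mu> + 4 * 0))"
      using \<open>\<mu> > 0\<close> by (intro tendsto_intros h_null) auto
    then show "(\<lambda>n. \<epsilon>1 * \<epsilon>2 * (h n)\<^sup>2 / (2 * (5 * \<mu> + 4 * h n))) \<longlonglongrightarrow> 0" by simp
  qed (use perturbation in auto)
  have incr_null: "(\<lambda>n. norm (x (Suc n) - x n)) \<longlonglongrightarrow> 0"
  proof (rule tendsto_sandwich[OF _ _ tendsto_const])
    have incr: "norm (x (Suc n) - x n) \<le> 2 * h n + norm (b n)" for n
    proof (cases "g (i n) (x n) > 0")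
      case True
      define c where "c = lam n * (g (i n) (x n) / (norm (t n))\<^sup>2)"
      have "0 \<le> lam n" "lam n \<le> 2"
        using \<open>\<epsilon>1 \<le> lam n\<close> \<open>lam n \<le> 2 - \<epsilon>2\<close> \<open>\<epsilon>1 > 0\<close> \<open>\<epsilon>2 > 0\<close> by auto
      have "x (Suc n) = best_approx \<Omega> (x n - c *\<^sub>R t n + b n)"
        using True by (simp add: step c_def)
      then have "norm (x (Suc n) - x n) \<le> norm (x n - c *\<^sub>R t n + b n - x n)"
        by (simp only: best_approx_closer[OF \<Omega>(2,3) x\<Omega>])
      also have "\<dots> = norm (b n - c *\<^sub>R t n)" by (simp add: algebra_simps)
      also have "\<dots> \<le> norm (b n) + norm (c *\<^sub>R t n)" by (rule norm_triangle_ineq4)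
      also have "norm (c *\<^sub>R t n) = lam n * h n"
        using True \<open>0 \<le> lam n\<close> by (simp add: c_def h_def power2_eq_square)
      also have "\<dots> \<le> 2 * h n" using \<open>lam n \<le> 2\<close> h_nonneg by (intro mult_right_mono)
      finally show ?thesis by simp
    qed (simp add: step h_nonneg)
    then show "\<forall>\<^sub>F n in sequentially. norm (x (Suc n) - x n) \<le> 2 * h n + norm (b n)" by simp
    have "(\<lambda>n. 2 * h n + norm (b n)) \<longlonglongrightarrow> 2 * 0 + 0" by (intro tendsto_intros h_null b_null)
    then show "(\<lambda>n. 2 * h n + norm (b n)) \<longlonglongrightarrow> 0" by simp
  qed auto
  have g_bound: "g (i n) (x n) \<le> K * h n" for n
  proof (cases "g (i n) (x n) > 0")
    case True
    have "t n \<noteq> 0"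
      using zero_subgradient_nonzero[OF t _ True] C\<Omega>[OF \<open>q \<in> C\<close>] by blast
    then have "g (i n) (x n) = norm (t n) * h n" using True by (simp add: h_def)
    also have "\<dots> \<le> K * h n" by (intro mult_right_mono K h_nonneg)
    finally show ?thesis .
  qed (use \<open>K > 0\<close> in \<open>simp add: h_def\<close>)

  have cluster: "z \<in> S" if r: "strict_mono r" and z: "weakly_tendsto (x \<circ> r) z" for r z
  proof -
    have "z \<in> \<Omega>" "z \<in> cball q \<mu>"
      using weak_limit_in_closed_convex[OF \<Omega>(2,3) _ z]
        weak_limit_in_closed_convex[OF closed_cball convex_cball _ z] x\<Omega> q_near by simp_all
    have "z \<in> zero_sublevel \<Omega> (g j)" if j: "j \<in> J" for j
    proof -
      obtain L where L: "\<And>s. s \<ge> 1 \<Longrightarrow> j \<in> i ` {s..s + L - 1}"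
        using control[OF j] by blast
      \<comment> \<open>The control speaks of windows with positive start only, hence the shift by one.\<close>
      have "\<exists>m. r k \<le> m \<and> m \<le> r k + L \<and> i m = j" for k
      proof -
        obtain m where "m \<in> {Suc (r k)..Suc (r k) + L - 1}" "j = i m"
          using L[of "Suc (r k)"] by auto
        then show ?thesis by (intro exI[of _ m]) auto
      qed
      then obtain m where m: "\<And>k. r k \<le> m k" "\<And>k. m k \<le> r k + L" "\<And>k. i (m k) = j"
        by metis
      have r_top: "filterlim r at_top sequentially" by (rule filterlim_subseq[OF r])
      have m_top: "filterlim m at_top sequentially"
        by (rule filterlim_at_top_mono[OF r_top]) (simp add: m)
      show ?thesis
      proof (rule weak_limit_in_zero_sublevel)
        show "weakly_seq_lsc_on \<Omega> (g j)" using \<open>j \<in> J\<close> by fact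
        show "weakly_tendsto (x \<circ> m) z"
          using weakly_tendsto_diff_null[OF z]
            null_increments_imp_null_bounded_gaps[OF incr_null r_top m(1,2)] by simp
        show "g j ((x \<circ> m) k) \<le> K * h (m k)" for k using g_bound[of "m k"] m(3) by simp
        have "(\<lambda>k. K * h (m k)) \<longlonglongrightarrow> K * 0"
          by (intro tendsto_mult tendsto_const filterlim_compose[OF h_null m_top])
        then show "(\<lambda>k. K * h (m k)) \<longlonglongrightarrow> 0" by simp
      qed (use x\<Omega> \<open>z \<in> \<Omega>\<close> in auto)
    qed
    moreover have "dist (x 0) z \<le> 2 * \<mu>"
      using dist_triangle[of "x 0" z q] q(2) \<open>z \<in> cball q \<mu>\<close> by simp
    ultimately show ?thesis by (simp add: S_def C_def)
  qed

  have "S \<noteq> {}" using qS by blast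
  from fejer_monotone_weakly_tendsto[OF fejer this cluster]
  obtain z where "z \<in> S" and z: "weakly_tendsto x z" ..
  have "x \<longlonglongrightarrow> z" if "(\<exists>B::'a set. finite B \<and> span B = UNIV) \<or> interior S \<noteq> {}"
    using that
  proof
    assume "\<exists>B::'a set. finite B \<and> span B = UNIV"
    then obtain B :: "'a set" where "finite B" "span B = UNIV" by blast
    then show ?thesis using z by (rule finite_dim_weakly_tendsto_imp_tendsto)
  next
    assume "interior S \<noteq> {}"
    then obtain l where l: "x \<longlonglongrightarrow> l"
      using fejer_monotone_interior_imp_convergent[OF fejer] convergent_def by blast
    then show ?thesis using weakly_tendsto_unique[OF z tendsto_imp_weakly_tendsto[OF l]] by simp
  qed
  with \<open>z \<in> S\<close> z show ?thesis unfolding S_def by blast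
qed

end
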